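(* There exists an absolute constant $C>0$ such that for every $n$ and every convex body $K$ in $\mathbb{R}^n$, $$N(K,D)\le\Sigma(CK)^C,\qquad\text{where}\quad D=\Big\{x\in\mathbb{R}^n:\ \frac1n\sum_{i=1}^n\exp\exp|x(i)|\le3\Big\}.$$
   Context: $N(K,D)$ is the covering number: the minimal number $N$ for which there exist points $x_1,\dots,x_N\in\mathbb{R}^n$ with $K\subseteq\bigcup_{j=1}^N(x_j+D)$. The cell content of a convex body $K\subset\mathbb{R}^n$ is $$\Sigma(K)=\sum_P\ (\text{number of integer cells contained in } PK),$$ where the sum is over all $2^n$ coordinate projections, i.e. the orthogonal projections $P$ of $\mathbb{R}^n$ onto $\mathbb{R}^\sigma$, $\sigma\subseteq\{1,\dots,n\}$ ($\mathbb{R}^\sigma$ = span of the coordinate vectors indexed by $\sigma$). The integer cells in $\mathbb{R}^\sigma$ are the sets $a+[0,1]^\sigma$ with $a\in\mathbb{Z}^\sigma$. The empty set $\sigma$ ($0$-dimensional projection) is included, and the corresponding summand equals $1$. *)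

theory Defs
  imports "HOL-Analysis.Analysis"
begin

text \<open>
  The constant in the theorem does not depend on the dimension, so the dimension has to be an
  ordinary variable. Hence \<open>\<real>\<^sup>n\<close> is the library space \<^const>\<open>Euclidean_space\<close> \<open>n\<close>, whose points
  are the functions \<open>x :: nat \<Rightarrow> real\<close> with \<open>x i = 0\<close> for all \<open>i \<ge> n\<close>; coordinates are indexed
  by \<open>0, \<dots>, n - 1\<close>. There is no vector space instance for this type, so vector operations are
  written coordinatewise.
\<close>

definition translate :: "(nat \<Rightarrow> real) \<Rightarrow> (nat \<Rightarrow> real) set \<Rightarrow> (nat \<Rightarrow> real) set" where
  "translate x D = (\<lambda>y i. x i + y i) ` D"

definition dilate :: "real \<Rightarrow> (nat \<Rightarrow> real) set \<Rightarrow> (nat \<Rightarrow> real) set" where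
  "dilate c K = (\<lambda>x i. c * x i) ` K"

definition convex_body :: "nat \<Rightarrow> (nat \<Rightarrow> real) set \<Rightarrow> bool" where
  "convex_body n K \<longleftrightarrow>
     compactin (Euclidean_space n) K \<and>
     (\<forall>x\<in>K. \<forall>y\<in>K. \<forall>u\<ge>0. \<forall>v\<ge>0. u + v = 1 \<longrightarrow> (\<lambda>i. u * x i + v * y i) \<in> K) \<and>
     Euclidean_space n interior_of K \<noteq> {}"

text \<open>The value is \<open>\<infinity>\<close> if there is no finite cover.\<close>

definition covering_number :: "nat \<Rightarrow> (nat \<Rightarrow> real) set \<Rightarrow> (nat \<Rightarrow> real) set \<Rightarrow> enat" where
  "covering_number n K D =
     Inf {enat N | N. \<exists>x :: nat \<Rightarrow> nat \<Rightarrow> real.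
            (\<forall>j\<in>{1..N}. x j \<in> topspace (Euclidean_space n)) \<and>
            K \<subseteq> (\<Union>j\<in>{1..N}. translate (x j) D)}"

text \<open>
  The subspace \<open>\<real>\<^sup>\<sigma>\<close> is identified with its copy inside \<open>\<real>\<^sup>n\<close>: coordinates outside \<open>\<sigma>\<close> are \<open>0\<close>.
\<close>

definition coord_proj :: "nat set \<Rightarrow> (nat \<Rightarrow> real) \<Rightarrow> (nat \<Rightarrow> real)" where
  "coord_proj \<sigma> x = (\<lambda>i. if i \<in> \<sigma> then x i else 0)"

definition integer_cells :: "nat set \<Rightarrow> (nat \<Rightarrow> real) set set" where
  "integer_cells \<sigma> =
     {translate (\<lambda>i. of_int (a i)) {x. (\<forall>i\<in>\<sigma>. 0 \<le> x i \<and> x i \<le> 1) \<and> (\<forall>i. i \<notin> \<sigma> \<longrightarrow> x i = 0)}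
      | a :: nat \<Rightarrow> int. \<forall>i. i \<notin> \<sigma> \<longrightarrow> a i = 0}"

text \<open>
  For compact \<open>K\<close> each set of cells below is finite. For nonempty \<open>K\<close> and \<open>\<sigma> = {}\<close> there is
  exactly one cell, the origin, so this summand is \<open>1\<close>.
\<close>

definition cell_content :: "nat \<Rightarrow> (nat \<Rightarrow> real) set \<Rightarrow> nat" where
  "cell_content n K =
     (\<Sum>\<sigma>\<in>Pow {..<n}. card {Q \<in> integer_cells \<sigma>. Q \<subseteq> coord_proj \<sigma> ` K})"

definition exp_exp_body :: "nat \<Rightarrow> (nat \<Rightarrow> real) set" where
  "exp_exp_body n =
     {x \<in> topspace (Euclidean_space n). (1 / real n) * (\<Sum>i<n. exp (exp \<bar>x i\<bar>)) \<le> 3}"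

end

theory Submission
  imports Defs
begin

text \<open>
  A maximal subset of \<open>K\<close> whose differences avoid \<open>D\<close> is a set of centres of a cover of \<open>K\<close> by
  translates of \<open>D\<close>. So it suffices to show that a finite set \<open>A \<subseteq> C K\<close> that is separated in this
  sense (after rescaling by \<open>C\<close>) has at most \<open>\<Sigma>(C K)\<^sup>4\<close> elements.

  Two facts combine. The first is superadditivity of the cell content
  (\<open>card_cell_indices_split\<close>): if a convex \<open>K\<close> is cut along a coordinate into the parts
  \<open>x i \<le> a\<close> and \<open>x i \<ge> a + 1\<close> with \<open>a\<close> an integer, then the cell contents of the two parts add up
  to at most that of \<open>K\<close>, because a cell occurring in a projection of both parts
  can be thickened in direction \<open>i\<close> to a new cell of \<open>K\<close>. The second
  (\<open>separated_set_splits\<close>) says that a separated set \<open>A\<close> with at least two points can be cut in this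
  way, into nonempty parts with \<open>|A|\<^sup>1\<^sup>/\<^sup>4 \<le> |A\<^sub>-|\<^sup>1\<^sup>/\<^sup>4 + |A\<^sub>+|\<^sup>1\<^sup>/\<^sup>4\<close>. Repeating such cuts down to single points
  gives \<open>|A|\<^sup>1\<^sup>/\<^sup>4 \<le> \<Sigma>(C K)\<close>
  (\<open>root_card_le_cell_indices\<close>).

  The double exponential in \<open>D\<close> comes from the second fact. Suppose that no cut of a coordinate,
  regarded as a random variable \<open>X\<close> on \<open>A\<close>, is efficient. If \<open>t\<close> is the proportion of \<open>X > a\<close> and
  \<open>t \<le> 1/2\<close>, then the proportion of \<open>X \<ge> a + 1\<close> is at most \<open>(1 - (1 - t)\<^sup>1\<^sup>/\<^sup>4)\<^sup>4 \<le> (t/2)\<^sup>4\<close>: each unit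
  step away from a median raises the tail to a power, so the tails decay doubly exponentially and
  a double exponential moment of \<open>X\<close> about the median is close to its least possible value
  \<open>e < 3\<close>. If this holds for every coordinate, then some two points of \<open>A\<close> lie so close to the
  vector of medians that their rescaled difference lies in \<open>D\<close>, and \<open>A\<close> is not separated.
\<close>

section \<open>Superadditivity of the cell content\<close>

definition cell :: "nat set \<Rightarrow> (nat \<Rightarrow> int) \<Rightarrow> (nat \<Rightarrow> real) set" where
  "cell \<sigma> a = {x. (\<forall>i\<in>\<sigma>. of_int (a i) \<le> x i \<and> x i \<le> of_int (a i) + 1) \<and> (\<forall>i. i \<notin> \<sigma> \<longrightarrow> x i = 0)}"

text \<open>
  Cells of projections are recorded by direction set and lower corner, so that one set
  collects the cells of all the projections.
\<close>

definition cell_indices :: "nat \<Rightarrow> (nat \<Rightarrow> real) set \<Rightarrow> (nat set \<times> (nat \<Rightarrow> int)) set" where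
  "cell_indices n K =
     {(\<sigma>, a). \<sigma> \<subseteq> {..<n} \<and> (\<forall>i. i \<notin> \<sigma> \<longrightarrow> a i = 0) \<and> cell \<sigma> a \<subseteq> coord_proj \<sigma> ` K}"

definition coord_convex :: "(nat \<Rightarrow> real) set \<Rightarrow> bool" where
  "coord_convex K \<longleftrightarrow>
     (\<forall>x\<in>K. \<forall>y\<in>K. \<forall>u\<ge>0. \<forall>v\<ge>0. u + v = 1 \<longrightarrow> (\<lambda>i. u * x i + v * y i) \<in> K)"

definition coord_bounded :: "nat \<Rightarrow> (nat \<Rightarrow> real) set \<Rightarrow> bool" where
  "coord_bounded n K \<longleftrightarrow> (\<exists>B::int. \<forall>x\<in>K. \<forall>i<n. \<bar>x i\<bar> \<le> of_int B)"

lemma corner_in_cell: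
  assumes "\<forall>i. i \<notin> \<sigma> \<longrightarrow> a i = 0"
  shows "(\<lambda>i. of_int (a i)) \<in> cell \<sigma> a"
  using assms by (auto simp: cell_def)

lemma translated_unit_cell:
  assumes "\<forall>i. i \<notin> \<sigma> \<longrightarrow> a i = 0"
  shows "translate (\<lambda>i. of_int (a i)) {x. (\<forall>i\<in>\<sigma>. 0 \<le> x i \<and> x i \<le> 1) \<and> (\<forall>i. i \<notin> \<sigma> \<longrightarrow> x i = 0)}
           = cell \<sigma> a" (is "translate ?c ?U = _")
proof
  show "translate ?c ?U \<subseteq> cell \<sigma> a"
    using assms by (auto simp: translate_def cell_def)
  show "cell \<sigma> a \<subseteq> translate ?c ?U"
  proof
    fix x assume "x \<in> cell \<sigma> a"
    then have "(\<lambda>i. x i - of_int (a i)) \<in> ?U"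
      using assms by (auto simp: cell_def algebra_simps)
    then show "x \<in> translate ?c ?U"
      unfolding translate_def by (rule rev_image_eqI) simp
  qed
qed

lemma integer_cells_eq: "integer_cells \<sigma> = cell \<sigma> ` {a. \<forall>i. i \<notin> \<sigma> \<longrightarrow> a i = 0}"
  unfolding integer_cells_def using translated_unit_cell by auto

text \<open>The lower corner of a cell is its least point.\<close>

lemma inj_on_cell: "inj_on (cell \<sigma>) {a. \<forall>i. i \<notin> \<sigma> \<longrightarrow> a i = 0}"
proof (rule inj_onI)
  fix a b assume a: "a \<in> {a. \<forall>i. i \<notin> \<sigma> \<longrightarrow> a i = 0}" and b: "b \<in> {a. \<forall>i. i \<notin> \<sigma> \<longrightarrow> a i = 0}"
    and eq: "cell \<sigma> a = cell \<sigma> b"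
  have "(\<lambda>i. of_int (a i)) \<in> cell \<sigma> b" "(\<lambda>i. of_int (b i)) \<in> cell \<sigma> a"
    using corner_in_cell[of \<sigma> a] corner_in_cell[of \<sigma> b] a b eq by auto
  then have "a i = b i" if "i \<in> \<sigma>" for i
    using that unfolding cell_def by force
  moreover have "a i = b i" if "i \<notin> \<sigma>" for i
    using that a b by simp
  ultimately show "a = b" by blast
qed

lemma finite_cell_indices:
  assumes "coord_bounded n K"
  shows "finite (cell_indices n K)"
proof -
  obtain B :: int where B: "\<And>x i. x \<in> K \<Longrightarrow> i < n \<Longrightarrow> \<bar>x i\<bar> \<le> of_int B"
    using assms unfolding coord_bounded_def by blast
  have "cell_indices n K \<subseteq>
      Pow {..<n} \<times> {a. \<forall>i. (i \<in> {..<n} \<longrightarrow> a i \<in> {-\<bar>B\<bar>..\<bar>B\<bar>}) \<and> (i \<notin> {..<n} \<longrightarrow> a i = 0)}"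
  proof (clarsimp simp: cell_indices_def, intro conjI allI impI)
    fix \<sigma> a i assume s: "\<sigma> \<subseteq> {..<n}" and a: "\<forall>i. i \<notin> \<sigma> \<longrightarrow> a i = 0"
      and sub: "cell \<sigma> a \<subseteq> coord_proj \<sigma> ` K"
    obtain x where x: "x \<in> K" "(\<lambda>i. of_int (a i)) = coord_proj \<sigma> x"
      using sub corner_in_cell[OF a] by blast
    show "a i = 0" if "\<not> i < n"
      using that s a by auto
    have "- \<bar>B\<bar> \<le> a i \<and> a i \<le> \<bar>B\<bar>" if i: "i < n"
    proof (cases "i \<in> \<sigma>")
      case True
      then have "of_int (a i) = x i"
        using fun_cong[OF x(2), of i] by (simp add: coord_proj_def)
      then have "\<bar>of_int (a i) :: real\<bar> \<le> of_int B" using B[OF x(1) i] by simp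
      then show ?thesis by linarith
    qed (use a in auto)
    then show "i < n \<Longrightarrow> - \<bar>B\<bar> \<le> a i" "i < n \<Longrightarrow> a i \<le> \<bar>B\<bar>" by auto
  qed
  moreover have "finite \<dots>"
    by (intro finite_cartesian_product finite_set_of_finite_funs) auto
  ultimately show ?thesis by (rule finite_subset)
qed

lemma cell_content_eq_card:
  assumes "coord_bounded n K"
  shows "cell_content n K = card (cell_indices n K)"
proof -
  define G where "G \<sigma> = {a. (\<forall>i. i \<notin> \<sigma> \<longrightarrow> a i = 0) \<and> cell \<sigma> a \<subseteq> coord_proj \<sigma> ` K}"
    for \<sigma> :: "nat set"
  have Sig: "cell_indices n K = Sigma (Pow {..<n}) G"
    by (auto simp: cell_indices_def G_def)
  have fin: "finite (G \<sigma>)" if "\<sigma> \<in> Pow {..<n}" for \<sigma>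
  proof -
    have "G \<sigma> \<subseteq> snd ` cell_indices n K"
    proof
      fix a assume "a \<in> G \<sigma>"
      then have "(\<sigma>, a) \<in> cell_indices n K" unfolding Sig using that by blast
      then show "a \<in> snd ` cell_indices n K" by (rule rev_image_eqI) simp
    qed
    then show ?thesis
      using finite_cell_indices[OF assms] finite_subset by blast
  qed
  have "card {Q \<in> integer_cells \<sigma>. Q \<subseteq> coord_proj \<sigma> ` K} = card (G \<sigma>)" for \<sigma>
  proof -
    have "{Q \<in> integer_cells \<sigma>. Q \<subseteq> coord_proj \<sigma> ` K} = cell \<sigma> ` G \<sigma>"
      by (auto simp: integer_cells_eq G_def)
    moreover have "inj_on (cell \<sigma>) (G \<sigma>)"
      by (rule inj_on_subset[OF inj_on_cell]) (auto simp: G_def)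
    ultimately show ?thesis by (simp add: card_image)
  qed
  then show ?thesis
    unfolding cell_content_def Sig using fin by (simp add: card_SigmaI)
qed

lemma cell_indices_mono: "K \<subseteq> L \<Longrightarrow> cell_indices n K \<subseteq> cell_indices n L"
  unfolding cell_indices_def by blast

lemma coord_bounded_subset: "coord_bounded n L \<Longrightarrow> K \<subseteq> L \<Longrightarrow> coord_bounded n K"
  unfolding coord_bounded_def by blast

lemma card_cell_indices_pos:
  assumes "coord_bounded n K" "K \<noteq> {}"
  shows "card (cell_indices n K) \<ge> 1"
proof -
  have "({}, \<lambda>_. 0) \<in> cell_indices n K"
    using assms(2) by (auto simp: cell_indices_def cell_def coord_proj_def)
  then show ?thesis
    using finite_cell_indices[OF assms(1)] by (auto simp: Suc_le_eq card_gt_0_iff)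
qed

text \<open>
  By convexity, every value between \<open>a\<close> and \<open>a + 1\<close> of the \<open>i\<close>-th coordinate is attained
  above a common projection of the two parts.
\<close>

lemma thickened_cell:
  assumes conv: "coord_convex K" and i: "i \<notin> \<sigma>"
    and lo: "cell \<sigma> b \<subseteq> coord_proj \<sigma> ` {x \<in> K. x i \<le> of_int a}"
    and hi: "cell \<sigma> b \<subseteq> coord_proj \<sigma> ` {x \<in> K. x i \<ge> of_int a + 1}"
  shows "cell (insert i \<sigma>) (b(i := a)) \<subseteq> coord_proj (insert i \<sigma>) ` K"
proof
  fix q assume q: "q \<in> cell (insert i \<sigma>) (b(i := a))"
  have qi: "of_int a \<le> q i" "q i \<le> of_int a + 1"
    using q by (auto simp: cell_def)
  have "of_int (b j) \<le> q j \<and> q j \<le> of_int (b j) + 1" if "j \<in> \<sigma>" for j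
  proof -
    have "\<forall>j\<in>insert i \<sigma>. of_int ((b(i := a)) j) \<le> q j \<and> q j \<le> of_int ((b(i := a)) j) + 1"
      using q unfolding cell_def by blast
    moreover have "j \<noteq> i" using that i by blast
    ultimately show ?thesis using that by (metis fun_upd_other insertCI)
  qed
  then have "coord_proj \<sigma> q \<in> cell \<sigma> b"
    by (simp add: cell_def coord_proj_def)
  then obtain y z where y: "y \<in> K" "y i \<le> of_int a" "coord_proj \<sigma> q = coord_proj \<sigma> y"
    and z: "z \<in> K" "z i \<ge> of_int a + 1" "coord_proj \<sigma> q = coord_proj \<sigma> z"
    using lo hi by blast
  \<comment> \<open>the parameter at which the segment from \<open>y\<close> to \<open>z\<close> has \<open>i\<close>-th coordinate \<open>q i\<close>\<close>
  define v where "v = (q i - y i) / (z i - y i)"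
  have v: "0 \<le> v" "v \<le> 1"
    using qi y z by (auto simp: v_def divide_simps)
  have "v * (z i - y i) = q i - y i"
    unfolding v_def using y z by simp
  then have vi: "(1 - v) * y i + v * z i = q i"
    by (simp add: algebra_simps)
  define w where "w = (\<lambda>j. (1 - v) * y j + v * z j)"
  have "w \<in> K"
    unfolding w_def
    using conv[unfolded coord_convex_def, rule_format, OF y(1) z(1), of "1 - v" v] v by simp
  moreover have "q = coord_proj (insert i \<sigma>) w"
  proof
    fix j
    consider "j = i" | "j \<noteq> i" "j \<in> \<sigma>" | "j \<noteq> i" "j \<notin> \<sigma>" by blast
    then show "q j = coord_proj (insert i \<sigma>) w j"
    proof cases
      case 2
      then have "y j = q j" "z j = q j"
        using fun_cong[OF y(3), of j] fun_cong[OF z(3), of j] by (auto simp: coord_proj_def)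
      then show ?thesis using 2 by (simp add: coord_proj_def w_def algebra_simps)
    qed (use q vi in \<open>auto simp: coord_proj_def w_def cell_def\<close>)
  qed
  ultimately show "q \<in> coord_proj (insert i \<sigma>) ` K" by blast
qed

text \<open>
  Cells belonging to just one part are cells of \<open>K\<close>. A cell belonging to both
  parts does not extend in direction \<open>i\<close> and counts twice on the left; it also counts
  twice on the right, once as itself and once thickened to \<open>[a, a + 1]\<close> in direction \<open>i\<close>. Such a
  thickened cell belongs to neither part, since it contains points with \<open>x i = a\<close> and with
  \<open>x i = a + 1\<close>.
\<close>

lemma card_cell_indices_split:
  assumes conv: "coord_convex K" and bd: "coord_bounded n K" and i: "i < n"
  shows "card (cell_indices n {x \<in> K. x i \<le> of_int a}) +
         card (cell_indices n {x \<in> K. x i \<ge> of_int a + 1}) \<le> card (cell_indices n K)"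
proof -
  define L where "L = cell_indices n {x \<in> K. x i \<le> of_int a}"
  define H where "H = cell_indices n {x \<in> K. x i \<ge> of_int a + 1}"
  define \<phi> where "\<phi> = (\<lambda>(\<sigma>, b::nat \<Rightarrow> int). (insert i \<sigma>, b(i := a)))"
  have LHK: "L \<subseteq> cell_indices n K" "H \<subseteq> cell_indices n K"
    unfolding L_def H_def by (auto intro!: cell_indices_mono)
  have finK: "finite (cell_indices n K)" by (rule finite_cell_indices[OF bd])
  have fin: "finite L" "finite H"
    using LHK finK finite_subset by auto
  have notin: "i \<notin> \<sigma>" if "(\<sigma>, b) \<in> L \<inter> H" for \<sigma> b
  proof
    assume mem: "i \<in> \<sigma>"
    have z: "\<forall>i. i \<notin> \<sigma> \<longrightarrow> b i = 0"
      using that by (auto simp: L_def cell_indices_def)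
    have "cell \<sigma> b \<subseteq> coord_proj \<sigma> ` {x \<in> K. x i \<le> of_int a}"
      and "cell \<sigma> b \<subseteq> coord_proj \<sigma> ` {x \<in> K. x i \<ge> of_int a + 1}"
      using that unfolding L_def H_def cell_indices_def by blast+
    then obtain y z where "y i \<le> of_int a" "(\<lambda>i. of_int (b i)) = coord_proj \<sigma> y"
      and "z i \<ge> of_int a + 1" "(\<lambda>i. of_int (b i)) = coord_proj \<sigma> z"
      using corner_in_cell[OF z] by blast
    then have "coord_proj \<sigma> y i = coord_proj \<sigma> z i" "y i < z i" by auto
    then show False using mem by (simp add: coord_proj_def)
  qed
  have "inj_on \<phi> (L \<inter> H)"
  proof (rule inj_onI)
    fix p q assume p: "p \<in> L \<inter> H" and q: "q \<in> L \<inter> H" and eq': "\<phi> p = \<phi> q"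
    obtain \<sigma> b \<tau> c where pq: "p = (\<sigma>, b)" "q = (\<tau>, c)" by (metis surj_pair)
    then have eq: "\<phi> (\<sigma>, b) = \<phi> (\<tau>, c)"
      and s: "(\<sigma>, b) \<in> L" "(\<sigma>, b) \<in> H" and t: "(\<tau>, c) \<in> L" "(\<tau>, c) \<in> H"
      using p q eq' by auto
    have ni: "i \<notin> \<sigma>" "i \<notin> \<tau>" using notin s t by blast+
    have ins: "insert i \<sigma> = insert i \<tau>" and upd: "b(i := a) = c(i := a)"
      using eq by (auto simp: \<phi>_def)
    have "b i = 0" "c i = 0"
      using ni s t by (auto simp: L_def cell_indices_def)
    then have "b = c"
      using upd by (metis fun_upd_triv fun_upd_upd)
    moreover have "\<sigma> = \<tau>" using ins ni by (simp add: insert_ident)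
    ultimately show "p = q" using pq by blast
  qed
  then have c\<phi>: "card (\<phi> ` (L \<inter> H)) = card (L \<inter> H)" by (rule card_image)
  have sub: "\<phi> ` (L \<inter> H) \<subseteq> cell_indices n K"
  proof (rule image_subsetI)
    fix p assume p: "p \<in> L \<inter> H"
    obtain \<sigma> b where pe: "p = (\<sigma>, b)" by (metis surj_pair)
    with p have s: "(\<sigma>, b) \<in> L" "(\<sigma>, b) \<in> H" by auto
    then have "cell (insert i \<sigma>) (b(i := a)) \<subseteq> coord_proj (insert i \<sigma>) ` K"
      by (intro thickened_cell conv notin[of \<sigma> b]) (auto simp: L_def H_def cell_indices_def)
    then show "\<phi> p \<in> cell_indices n K"
      using s i pe by (auto simp: \<phi>_def L_def cell_indices_def)
  qed
  \<comment> \<open>In direction \<open>i\<close> the thickened cell reaches up to \<open>a + 1\<close> and down to \<open>a\<close>.\<close>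
  have disj: "\<phi> ` (L \<inter> H) \<inter> (L \<union> H) = {}"
  proof -
    have False if s: "(\<sigma>, b) \<in> L \<inter> H" and t: "(insert i \<sigma>, b(i := a)) \<in> L \<union> H" for \<sigma> b
    proof -
      let ?c = "b(i := a)"
      have z: "\<forall>j. j \<notin> insert i \<sigma> \<longrightarrow> ?c j = 0"
        using s by (auto simp: L_def cell_indices_def)
      have low: "(\<lambda>j. of_int (?c j)) \<in> cell (insert i \<sigma>) ?c"
        by (rule corner_in_cell[OF z])
      then have up: "(\<lambda>j. of_int (?c j))(i := of_int a + 1) \<in> cell (insert i \<sigma>) ?c"
        by (auto simp: cell_def)
      from t show False
      proof
        assume "(insert i \<sigma>, ?c) \<in> L"
        then obtain y where "y i \<le> of_int a"
          "(\<lambda>j. of_int (?c j))(i := of_int a + 1) = coord_proj (insert i \<sigma>) y"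
          using up unfolding L_def cell_indices_def by blast
        from this(1) fun_cong[OF this(2), of i] show False by (simp add: coord_proj_def)
      next
        assume "(insert i \<sigma>, ?c) \<in> H"
        then obtain y where "y i \<ge> of_int a + 1"
          "(\<lambda>j. of_int (?c j)) = coord_proj (insert i \<sigma>) y"
          using low unfolding H_def cell_indices_def by blast
        from this(1) fun_cong[OF this(2), of i] show False by (simp add: coord_proj_def)
      qed
    qed
    then show ?thesis by (auto simp: \<phi>_def)
  qed
  have "card L + card H = card (L \<union> H) + card (L \<inter> H)"
    by (rule card_Un_Int[OF fin])
  also have "\<dots> = card (L \<union> H \<union> \<phi> ` (L \<inter> H))"
    using fin disj c\<phi> by (subst card_Un_disjoint) auto
  also have "\<dots> \<le> card (cell_indices n K)"
    using LHK sub by (intro card_mono finK) auto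
  finally show ?thesis unfolding L_def H_def .
qed

text \<open>
  The number of cells dominates the fourth root of the number of points, since both behave well
  under an efficient cut: the former is superadditive, the latter subadditive by hypothesis.
\<close>

lemma root_card_le_cell_indices:
  assumes "coord_convex K" "coord_bounded n K" "finite A" "A \<subseteq> K" "A \<noteq> {}"
    and split: "\<And>B. B \<subseteq> A \<Longrightarrow> card B \<ge> 2 \<Longrightarrow> \<exists>i<n. \<exists>a::int.
       {x \<in> B. x i \<le> of_int a} \<noteq> {} \<and> {x \<in> B. x i \<ge> of_int a + 1} \<noteq> {} \<and>
       root 4 (card B) \<le> root 4 (card {x \<in> B. x i \<le> of_int a}) + root 4 (card {x \<in> B. x i \<ge> of_int a + 1})"
  shows "root 4 (card A) \<le> card (cell_indices n K)"
  using assms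
proof (induction "card A" arbitrary: A K rule: less_induct)
  case less
  note split = less.prems(6)
  show ?case
  proof (cases "card A \<ge> 2")
    case False
    then have "card A = 1"
      using less.prems(3,5) card_gt_0_iff[of A] by linarith
    moreover have "K \<noteq> {}" using less.prems by blast
    ultimately show ?thesis using card_cell_indices_pos[OF less.prems(2)] by simp
  next
    case True
    then obtain i and a :: int where i: "i < n"
      and ne: "{x \<in> A. x i \<le> of_int a} \<noteq> {}" "{x \<in> A. x i \<ge> of_int a + 1} \<noteq> {}"
      and r: "root 4 (card A) \<le> root 4 (card {x \<in> A. x i \<le> of_int a})
                + root 4 (card {x \<in> A. x i \<ge> of_int a + 1})"
      using split[of A] by blast
    let ?A1 = "{x \<in> A. x i \<le> of_int a}" and ?A2 = "{x \<in> A. x i \<ge> of_int a + 1}"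
    let ?K1 = "{x \<in> K. x i \<le> of_int a}" and ?K2 = "{x \<in> K. x i \<ge> of_int a + 1}"
    have "?A1 \<subset> A" "?A2 \<subset> A"
      using ne by force+
    then have c: "card ?A1 < card A" "card ?A2 < card A"
      using less.prems(3) psubset_card_mono by blast+
    have conv: "coord_convex ?K1"
      unfolding coord_convex_def
    proof (intro ballI allI impI CollectI conjI)
      fix x y and u v :: real assume *: "x \<in> ?K1" "y \<in> ?K1" "0 \<le> u" "0 \<le> v" "u + v = 1"
      show "(\<lambda>i. u * x i + v * y i) \<in> K"
        using * less.prems(1) unfolding coord_convex_def by blast
      have "u * x i + v * y i \<le> u * of_int a + v * of_int a"
        using * by (intro add_mono mult_left_mono) auto
      also have "\<dots> = of_int a" using *(5) by (metis distrib_right mult_1)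
      finally show "u * x i + v * y i \<le> of_int a" .
    qed
    have conv': "coord_convex ?K2"
      unfolding coord_convex_def
    proof (intro ballI allI impI CollectI conjI)
      fix x y and u v :: real assume *: "x \<in> ?K2" "y \<in> ?K2" "0 \<le> u" "0 \<le> v" "u + v = 1"
      show "(\<lambda>i. u * x i + v * y i) \<in> K"
        using * less.prems(1) unfolding coord_convex_def by blast
      have "of_int a + 1 = u * (of_int a + 1) + v * (of_int a + 1)"
        using *(5) by (metis distrib_right mult_1)
      also have "\<dots> \<le> u * x i + v * y i"
        using * by (intro add_mono mult_left_mono) auto
      finally show "of_int a + 1 \<le> u * x i + v * y i" .
    qed
    have "root 4 (card ?A1) \<le> card (cell_indices n ?K1)"
    proof (rule less.hyps[OF c(1) conv])
      fix B assume "B \<subseteq> ?A1" "2 \<le> card B"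
      then show "\<exists>i<n. \<exists>a::int. {x \<in> B. x i \<le> of_int a} \<noteq> {} \<and> {x \<in> B. x i \<ge> of_int a + 1} \<noteq> {} \<and>
         root 4 (card B) \<le> root 4 (card {x \<in> B. x i \<le> of_int a}) + root 4 (card {x \<in> B. x i \<ge> of_int a + 1})"
        by (intro split) auto
    qed (use less.prems ne in \<open>auto intro: coord_bounded_subset\<close>)
    moreover have "root 4 (card ?A2) \<le> card (cell_indices n ?K2)"
    proof (rule less.hyps[OF c(2) conv'])
      fix B assume "B \<subseteq> ?A2" "2 \<le> card B"
      then show "\<exists>i<n. \<exists>a::int. {x \<in> B. x i \<le> of_int a} \<noteq> {} \<and> {x \<in> B. x i \<ge> of_int a + 1} \<noteq> {} \<and>
         root 4 (card B) \<le> root 4 (card {x \<in> B. x i \<le> of_int a}) + root 4 (card {x \<in> B. x i \<ge> of_int a + 1})"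
        by (intro split) auto
    qed (use less.prems ne in \<open>auto intro: coord_bounded_subset\<close>)
    moreover have "card (cell_indices n ?K1) + card (cell_indices n ?K2) \<le> card (cell_indices n K)"
      by (rule card_cell_indices_split[OF less.prems(1,2) i])
    ultimately show ?thesis using r by linarith
  qed
qed

section \<open>Concentration of a function without efficient cuts\<close>

text \<open>
  Since \<open>(1 - t/2)\<^sup>4 \<le> 1 - t\<close> for \<open>t \<le> 1/2\<close>, the fourth root of \<open>1 - t\<close> is at least \<open>1 - t/2\<close>,
  which leaves at most \<open>t/2\<close> for that of \<open>q\<close>.
\<close>

lemma inefficient_cut_bound:
  fixes t q :: real
  assumes t: "0 \<le> t" "t \<le> 1/2" and q: "0 \<le> q" and lt: "root 4 (1 - t) + root 4 q < 1"
  shows "q \<le> (t / 2) ^ 4"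
proof -
  have a: "(1 - t/2) ^ 2 \<le> 1 - 3/4 * t"
    using t mult_left_mono[of t 1 t] by (simp add: power2_eq_square algebra_simps)
  have "(1 - t/2) ^ 4 = ((1 - t/2) ^ 2) ^ 2" by simp
  also have "\<dots> \<le> (1 - 3/4 * t) ^ 2"
    using a by (rule power_mono) simp
  also have "\<dots> \<le> 1 - t"
    using t mult_left_mono[of t "1/2" t] by (simp add: power2_eq_square algebra_simps)
  finally have "root 4 ((1 - t/2) ^ 4) \<le> root 4 (1 - t)" by simp
  then have "1 - t/2 \<le> root 4 (1 - t)"
    using t by (simp add: real_root_power_cancel)
  then have "root 4 q \<le> t/2" using lt by linarith
  then have "root 4 q ^ 4 \<le> (t/2) ^ 4"
    by (rule power_mono) (use q in simp)
  then show ?thesis using q by simp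
qed

primrec tail_bound :: "nat \<Rightarrow> real" where
  "tail_bound 0 = 1/2"
| "tail_bound (Suc k) = (tail_bound k / 2) ^ 4"

lemma tail_bound_range: "0 < tail_bound k \<and> tail_bound k \<le> 1/2"
proof (induction k)
  case (Suc k)
  have "(tail_bound k / 2) ^ 4 \<le> (1/2) ^ 4"
    using Suc by (intro power_mono) auto
  then show ?case using Suc by (auto simp: power_one_over)
qed simp

text \<open>
  Only cuts with two nonempty parts are considered: a cut with an empty part gives equality of
  the roots, but makes no progress.
\<close>

definition no_efficient_cut :: "'a set \<Rightarrow> ('a \<Rightarrow> real) \<Rightarrow> bool" where
  "no_efficient_cut A X \<longleftrightarrow> (\<forall>a::int.
     {x \<in> A. X x \<le> of_int a} \<noteq> {} \<longrightarrow> {x \<in> A. X x \<ge> of_int a + 1} \<noteq> {} \<longrightarrow>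
     root 4 (card {x \<in> A. X x \<le> of_int a}) + root 4 (card {x \<in> A. X x \<ge> of_int a + 1}) < root 4 (card A))"

lemma no_efficient_cut_uminus:
  assumes "no_efficient_cut A X"
  shows "no_efficient_cut A (\<lambda>x. - X x)"
  unfolding no_efficient_cut_def
proof (intro allI impI)
  fix a :: int
  have 1: "{x \<in> A. - X x \<le> of_int a} = {x \<in> A. X x \<ge> of_int (- a - 1) + 1}"
    and 2: "{x \<in> A. - X x \<ge> of_int a + 1} = {x \<in> A. X x \<le> of_int (- a - 1)}"
    by auto
  assume "{x \<in> A. - X x \<le> of_int a} \<noteq> {}" "{x \<in> A. - X x \<ge> of_int a + 1} \<noteq> {}"
  then show "root 4 (card {x \<in> A. - X x \<le> of_int a}) + root 4 (card {x \<in> A. - X x \<ge> of_int a + 1})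
               < root 4 (card A)"
    unfolding 1 2 using assms[unfolded no_efficient_cut_def, rule_format, of "- a - 1"]
    by linarith
qed

text \<open>
  The induction step is the cut between \<open>m + k\<close> and \<open>m + k + 1\<close>, to which
  \<open>inefficient_cut_bound\<close> applies with \<open>t\<close> the proportion of points above \<open>m + k\<close>.
\<close>

lemma upper_tail_bound:
  assumes fin: "finite A" and ne: "A \<noteq> {}" and cut: "no_efficient_cut A X"
    and m: "2 * card {x \<in> A. X x > of_int m} \<le> card A"
  shows "real (card {x \<in> A. X x > of_int m + real k}) \<le> tail_bound k * card A"
proof (induction k)
  case 0
  then show ?case using m by simp
next
  case (Suc k)
  define N where "N = real (card A)"
  have N: "N > 0" using fin ne by (simp add: N_def card_gt_0_iff)
  define a where "a = m + int k"
  let ?U = "{x \<in> A. X x > of_int a}" and ?L = "{x \<in> A. X x \<le> of_int a}"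
    and ?V = "{x \<in> A. X x \<ge> of_int a + 1}"
  have U: "real (card ?U) \<le> tail_bound k * N"
    using Suc.IH by (simp add: a_def N_def)
  have "A = ?U \<union> ?L" by auto
  then have "card A = card (?U \<union> ?L)" by simp
  also have "\<dots> = card ?U + card ?L"
    using fin by (intro card_Un_disjoint) auto
  finally have L: "card ?L / N = 1 - card ?U / N"
    using N by (simp add: N_def field_simps)
  have t1: "card ?U / N \<le> tail_bound k"
    using U N by (simp add: divide_simps)
  then have t: "0 \<le> card ?U / N" "card ?U / N \<le> 1/2"
    using N tail_bound_range[of k] by (simp, linarith)
  have "real (card ?V) / N \<le> tail_bound (Suc k)"
  proof (cases "?V = {}")
    case True
    then have "real (card ?V) / N = 0" by (simp only: card.empty)
    then show ?thesis using tail_bound_range[of "Suc k"] by linarith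
  next
    case False
    have "?L \<noteq> {}"
    proof
      assume "?L = {}"
      then have "card ?L / N = 0" by (simp only: card.empty)
      then show False using L t(2) by linarith
    qed
    with False have lt: "root 4 (card ?L) + root 4 (card ?V) < root 4 N"
      using cut unfolding no_efficient_cut_def N_def by blast
    have "root 4 (card ?L / N) + root 4 (card ?V / N) = (root 4 (card ?L) + root 4 (card ?V)) / root 4 N"
      by (simp add: real_root_divide add_divide_distrib)
    also have "\<dots> < 1" using lt N by simp
    finally have "real (card ?V) / N \<le> (card ?U / N / 2) ^ 4"
      unfolding L by (intro inefficient_cut_bound t) (use N in auto)
    also have "\<dots> \<le> (tail_bound k / 2) ^ 4"
      using t1 t by (intro power_mono) auto
    finally show ?thesis by simp
  qed
  then have "real (card ?V) \<le> tail_bound (Suc k) * N"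
    using N by (simp add: field_simps)
  moreover have "card {x \<in> A. X x > of_int m + real (Suc k)} \<le> card ?V"
    using fin by (intro card_mono) (auto simp: a_def)
  ultimately show ?case unfolding N_def by linarith
qed

text \<open>
  The two thresholds have to differ, since all values may lie strictly between \<open>m - 1\<close> and \<open>m\<close>.
  The integer \<open>m\<close> is where the distribution function first reaches \<open>1/2\<close> along the integers.
\<close>

lemma integer_median_exists:
  fixes X :: "'a \<Rightarrow> real"
  assumes fin: "finite A" and ne: "A \<noteq> {}"
  shows "\<exists>m::int. 2 * card {x \<in> A. X x > of_int m} \<le> card A \<and> 2 * card {x \<in> A. X x < of_int m - 1} \<le> card A"
proof -
  define M where "M = (\<Sum>x\<in>A. nat \<lceil>\<bar>X x\<bar>\<rceil>) + 1"
  have M: "\<bar>X x\<bar> < real M" if "x \<in> A" for x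
  proof -
    have "nat \<lceil>\<bar>X x\<bar>\<rceil> \<le> (\<Sum>x\<in>A. nat \<lceil>\<bar>X x\<bar>\<rceil>)"
      using fin that by (intro member_le_sum) auto
    then show ?thesis unfolding M_def by linarith
  qed
  define P where "P k \<longleftrightarrow> card A \<le> 2 * card {x \<in> A. X x \<le> of_int (int k - int M)}" for k
  have N: "card A > 0" using fin ne by (simp add: card_gt_0_iff)
  have "{x \<in> A. X x \<le> of_int (int 0 - int M)} = {}"
    using M by force
  then have "card {x \<in> A. X x \<le> of_int (int 0 - int M)} = 0" by (simp only: card.empty)
  then have "\<not> P 0" unfolding P_def using N by linarith
  moreover have "{x \<in> A. X x \<le> of_int (int (2 * M) - int M)} = A"
    using M by force
  then have "P (2 * M)" unfolding P_def by simp
  ultimately obtain k where k: "\<not> P k" "P (Suc k)"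
    using ex_least_nat_less[of P] by blast
  define m where "m = int (Suc k) - int M"
  have "{x \<in> A. X x > of_int m} = A - {x \<in> A. X x \<le> of_int m}" by auto
  then have "card {x \<in> A. X x > of_int m} = card A - card {x \<in> A. X x \<le> of_int m}"
    using fin by (simp add: card_Diff_subset)
  then have "2 * card {x \<in> A. X x > of_int m} \<le> card A"
    using k(2) unfolding P_def m_def by linarith
  moreover have "card {x \<in> A. X x < of_int m - 1} \<le> card {x \<in> A. X x \<le> of_int (int k - int M)}"
    using fin by (intro card_mono) (auto simp: m_def)
  then have "2 * card {x \<in> A. X x < of_int m - 1} \<le> card A"
    using k(1) unfolding P_def by linarith
  ultimately show ?thesis by blast
qed

definition weight :: "real \<Rightarrow> real" where
  "weight r = exp (exp (r / 200))"

lemma weight_mono: "r \<le> s \<Longrightarrow> weight r \<le> weight s"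
  by (simp add: weight_def)

lemma weight_2: "weight 2 \<le> 2.78" and weight_3: "weight 3 \<le> 3"
proof -
  have *: "weight r \<le> 2.72 * (1 + 0.016 + 0.016\<^sup>2)" if "r / 200 \<le> s" "0 \<le> s" "s + s\<^sup>2 \<le> 0.016" "s \<le> 1" for r s
  proof -
    have "exp (r / 200) \<le> exp s" using that by simp
    also have "\<dots> \<le> 1 + s + s\<^sup>2" using that by (intro exp_bound) auto
    also have "\<dots> \<le> 1 + 0.016" using that by simp
    finally have "weight r \<le> exp (1 + 0.016)" by (simp add: weight_def)
    also have "\<dots> = exp 1 * exp 0.016" by (rule exp_add)
    also have "\<dots> \<le> 2.72 * (1 + 0.016 + 0.016\<^sup>2)"
      using e_less_272 by (intro mult_mono exp_bound) auto
    finally show ?thesis .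
  qed
  show "weight 2 \<le> 2.78" using *[of 2 "0.01"] by (simp add: power2_eq_square)
  show "weight 3 \<le> 3" using *[of 3 "0.015"] by (simp add: power2_eq_square)
qed

lemma weight_step: "weight (r + 1) \<le> weight r ^ 2"
proof -
  have "exp (1/200 :: real) \<le> 1 + 1/200 + (1/200)\<^sup>2"
    by (intro exp_bound) auto
  then have "exp (1/200 :: real) \<le> 2" by (simp add: power2_eq_square)
  then have "exp (r / 200) * exp (1/200) \<le> exp (r / 200) * 2"
    by (intro mult_left_mono) auto
  then have "exp ((r + 1) / 200) \<le> 2 * exp (r / 200)"
    by (simp add: exp_add add_divide_distrib mult.commute)
  then have "weight (r + 1) \<le> exp (2 * exp (r / 200))"
    by (simp add: weight_def)
  also have "\<dots> = weight r ^ 2"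
    by (simp add: weight_def exp_double)
  finally show ?thesis .
qed

text \<open>
  One step raises the tail bound to the fourth power but the weight at most to the second, so the
  product shrinks at least geometrically. The weight at \<open>k + 3\<close> is the one met in the layer of
  points at distance between \<open>k + 2\<close> and \<open>k + 3\<close> from the median.
\<close>

lemma tail_bound_times_weight: "tail_bound (Suc k) * weight (real k + 3) \<le> 3/256 / 16 ^ k"
proof (induction k)
  case 0
  have b1: "tail_bound (Suc 0) = 1/256" by (simp add: power4_eq_xxxx)
  show ?case unfolding b1 using weight_3 by simp
next
  case (Suc k)
  let ?b = "tail_bound (Suc k)" and ?w = "weight (real k + 3)"
  have b: "0 < ?b" "?b \<le> 1/2" using tail_bound_range by blast+
  have w: "?w > 0" by (simp add: weight_def)
  have bw: "?b * ?w \<le> 1"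
  proof (rule order_trans[OF Suc])
    have "(1::real) \<le> 16 ^ k" by simp
    then have "(3::real) \<le> 256 * 16 ^ k" by linarith
    then show "3/256 / 16 ^ k \<le> (1::real)" by (simp add: divide_simps)
  qed
  have "tail_bound (Suc (Suc k)) * weight (real (Suc k) + 3) \<le> (?b / 2) ^ 4 * ?w ^ 2"
    using weight_step[of "real k + 3"] by (auto intro!: mult_mono simp: algebra_simps)
  also have "\<dots> = (?b * ?w) * ((?b * ?w) * ?b ^ 2) / 16"
    by (simp add: power2_eq_square power4_eq_xxxx)
  also have "\<dots> \<le> (?b * ?w) * (1 * 1 ^ 2) / 16"
    using b w bw by (intro divide_right_mono mult_left_mono mult_mono power_mono) auto
  also have "\<dots> \<le> (3/256 / 16 ^ k) / 16"
    using Suc by simp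
  finally show ?case by (simp add: mult.commute)
qed

lemma sum_tail_bound_times_weight:
  "(\<Sum>k<M. tail_bound (Suc k) * weight (real k + 3)) \<le> 1/80"
proof -
  have "(\<Sum>k<M. tail_bound (Suc k) * weight (real k + 3)) \<le> (\<Sum>k<M. 3/256 / 16 ^ k)"
    by (intro sum_mono tail_bound_times_weight)
  also have "\<dots> = 1/80 * (1 - 1 / 16 ^ M)"
  proof (induction M)
    case (Suc M)
    show ?case unfolding sum.lessThan_Suc Suc.IH by (simp add: field_simps)
  qed simp
  also have "\<dots> \<le> 1/80" by simp
  finally show ?thesis .
qed

text \<open>
  The weight is split over the layers \<open>k + 2 < |X - m| \<le> k + 3\<close>. On the bulk \<open>|X - m| \<le> 2\<close> it is at
  most \<open>weight 2\<close>, which is close to \<open>e\<close>; the tails contribute at most twice the preceding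
  sum, once for each side.
\<close>

lemma concentration:
  assumes fin: "finite A" and ne: "A \<noteq> {}" and cut: "no_efficient_cut A X"
  shows "\<exists>m::int. (\<Sum>x\<in>A. weight \<bar>X x - of_int m\<bar>) \<le> 2.85 * card A"
proof -
  define N where "N = real (card A)"
  have N: "N > 0" using fin ne by (simp add: N_def card_gt_0_iff)
  obtain m :: int where up: "2 * card {x \<in> A. X x > of_int m} \<le> card A"
    and lo: "2 * card {x \<in> A. X x < of_int m - 1} \<le> card A"
    using integer_median_exists[OF fin ne] by blast
  \<comment> \<open>The lower tail is measured from \<open>m - 1\<close>, one unit off the centre, so its first power gain
    comes at distance \<open>2\<close> from \<open>m\<close>.\<close>
  define T where "T k = {x \<in> A. \<bar>X x - of_int m\<bar> > real k + 2}" for k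
  have T: "card (T k) \<le> 2 * tail_bound (Suc k) * N" for k
  proof -
    have U: "real (card {x \<in> A. X x > of_int m + real (Suc k)}) \<le> tail_bound (Suc k) * N"
      unfolding N_def by (rule upper_tail_bound[OF fin ne cut up])
    have eq: "{x \<in> A. - X x > of_int (1 - m)} = {x \<in> A. X x < of_int m - 1}" by auto
    have L: "real (card {x \<in> A. - X x > of_int (1 - m) + real (Suc k)}) \<le> tail_bound (Suc k) * N"
      unfolding N_def
      by (rule upper_tail_bound[OF fin ne no_efficient_cut_uminus[OF cut]]) (unfold eq, rule lo)
    have "card (T k) \<le> card ({x \<in> A. X x > of_int m + real (Suc k)} \<union>
                             {x \<in> A. - X x > of_int (1 - m) + real (Suc k)})"
    proof (rule card_mono)
      show "T k \<subseteq> {x \<in> A. X x > of_int m + real (Suc k)} \<union>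
                   {x \<in> A. - X x > of_int (1 - m) + real (Suc k)}"
      proof
        fix x assume "x \<in> T k"
        then have "x \<in> A" "\<bar>X x - of_int m\<bar> > real k + 2" by (auto simp: T_def)
        moreover from this(2) have "X x > of_int m + real (Suc k) \<or> - X x > of_int (1 - m) + real (Suc k)"
          unfolding of_int_diff of_nat_Suc by linarith
        ultimately show "x \<in> {x \<in> A. X x > of_int m + real (Suc k)} \<union>
                   {x \<in> A. - X x > of_int (1 - m) + real (Suc k)}" by blast
      qed
    qed (use fin in simp)
    also have "\<dots> \<le> card {x \<in> A. X x > of_int m + real (Suc k)} +
                     card {x \<in> A. - X x > of_int (1 - m) + real (Suc k)}"
      by (rule card_Un_le)
    finally show ?thesis using U L by linarith
  qed
  define M where "M = (\<Sum>x\<in>A. nat \<lceil>\<bar>X x - of_int m\<bar>\<rceil>)"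
  have M: "\<bar>X x - of_int m\<bar> \<le> real M" if "x \<in> A" for x
  proof -
    have "nat \<lceil>\<bar>X x - of_int m\<bar>\<rceil> \<le> M"
      unfolding M_def using fin that by (intro member_le_sum) auto
    then show ?thesis by linarith
  qed
  have pt: "weight \<bar>X x - of_int m\<bar> \<le>
      weight 2 + (\<Sum>k<M. weight (real k + 3) * indicator (T k) x)" if x: "x \<in> A" for x
  proof -
    let ?r = "\<bar>X x - of_int m\<bar>"
    have pos: "weight r \<ge> 0" for r by (simp add: weight_def)
    show ?thesis
    proof (cases "?r \<le> 2")
      case True
      then show ?thesis
        using weight_mono[OF True] pos by (intro add_increasing2 sum_nonneg mult_nonneg_nonneg) auto
    next
      case False
      define k where "k = nat (\<lceil>?r\<rceil> - 3)"
      have k: "real k + 2 < ?r" "?r \<le> real k + 3"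
        using False unfolding k_def by linarith+
      have "k < M" using k(1) M[OF x] by linarith
      have "weight ?r \<le> weight (real k + 3)" by (rule weight_mono[OF k(2)])
      also have "\<dots> = weight (real k + 3) * indicator (T k) x"
        using k(1) x by (simp add: T_def)
      also have "\<dots> \<le> (\<Sum>k<M. weight (real k + 3) * indicator (T k) x)"
        using \<open>k < M\<close> pos by (intro member_le_sum[of k "{..<M}"]) auto
      finally show ?thesis using pos[of 2] by linarith
    qed
  qed
  have "(\<Sum>x\<in>A. weight \<bar>X x - of_int m\<bar>) \<le>
        (\<Sum>x\<in>A. weight 2 + (\<Sum>k<M. weight (real k + 3) * indicator (T k) x))"
    by (intro sum_mono pt)
  also have "\<dots> = weight 2 * N + (\<Sum>k<M. weight (real k + 3) * card (T k))"
  proof -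
    have "A \<inter> T k = T k" for k by (auto simp: T_def)
    then have "(\<Sum>x\<in>A. indicator (T k) x :: real) = card (T k)" for k
      using fin by (simp add: indicator_def sum.If_cases Int_def)
    then show ?thesis
      unfolding sum.distrib sum.swap[of _ "{..<M}" A] sum_distrib_left[symmetric]
      by (simp add: N_def)
  qed
  also have "\<dots> \<le> 2.78 * N + (\<Sum>k<M. weight (real k + 3) * (2 * tail_bound (Suc k) * N))"
  proof (rule add_mono)
    show "weight 2 * N \<le> 2.78 * N"
      using weight_2 N by (intro mult_right_mono) auto
    show "(\<Sum>k<M. weight (real k + 3) * card (T k))
            \<le> (\<Sum>k<M. weight (real k + 3) * (2 * tail_bound (Suc k) * N))"
      by (rule sum_mono, rule mult_left_mono[OF T]) (simp add: weight_def)
  qed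
  also have "(\<Sum>k<M. weight (real k + 3) * (2 * tail_bound (Suc k) * N))
      = 2 * N * (\<Sum>k<M. tail_bound (Suc k) * weight (real k + 3))"
    unfolding sum_distrib_left by (rule sum.cong) (simp_all only: ac_simps)
  also have "2.78 * N + 2 * N * (\<Sum>k<M. tail_bound (Suc k) * weight (real k + 3))
      \<le> 2.78 * N + 2 * N * (1/80)"
    using N by (intro add_left_mono mult_left_mono sum_tail_bound_times_weight) auto
  also have "\<dots> \<le> 2.85 * N" using N by simp
  finally show ?thesis unfolding N_def by blast
qed

section \<open>Separated sets\<close>

definition separated :: "nat \<Rightarrow> (nat \<Rightarrow> real) set \<Rightarrow> bool" where
  "separated n A \<longleftrightarrow> (\<forall>x\<in>A. \<forall>y\<in>A. x \<noteq> y \<longrightarrow> (\<lambda>i. x i - y i) \<notin> exp_exp_body n)"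

text \<open>The two smallest values have a mean not above the average of all.\<close>

lemma two_small_values:
  fixes F :: "'a \<Rightarrow> real" and c :: real
  assumes fin: "finite A" and card: "card A \<ge> 2" and avg: "(\<Sum>x\<in>A. F x) \<le> c * card A"
  shows "\<exists>x\<in>A. \<exists>y\<in>A. x \<noteq> y \<and> F x + F y \<le> 2 * c"
proof -
  have ne: "A \<noteq> {}" using card by auto
  define x where "x = arg_min_on F A"
  have x: "x \<in> A" "\<And>z. z \<in> A \<Longrightarrow> F x \<le> F z"
    unfolding x_def by (rule arg_min_if_finite(1)[OF fin ne], rule arg_min_least[OF fin ne])
  have cx: "card (A - {x}) = card A - 1" using x(1) by simp
  then have "card (A - {x}) \<noteq> 0" using card by linarith
  then have ne': "A - {x} \<noteq> {}" by (metis card.empty)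
  have fin': "finite (A - {x})" using fin by simp
  define y where "y = arg_min_on F (A - {x})"
  have y: "y \<in> A - {x}" "\<And>z. z \<in> A - {x} \<Longrightarrow> F y \<le> F z"
    unfolding y_def by (rule arg_min_if_finite(1)[OF fin' ne'], rule arg_min_least[OF fin' ne'])
  have "real (card (A - {x})) = real (card A) - 1"
    using cx card by linarith
  then have "(real (card A) - 1) * F y \<le> (\<Sum>z\<in>A - {x}. F z)"
    using sum_bounded_below[of "A - {x}" "F y" F] y(2) by (simp only:)
  moreover have "(\<Sum>z\<in>A. F z) = F x + (\<Sum>z\<in>A - {x}. F z)"
    by (rule sum.remove[OF fin x(1)])
  ultimately have avg': "F x + (real (card A) - 1) * F y \<le> c * card A"
    using avg by linarith
  have "0 \<le> (real (card A) - 2) * (F y - F x)"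
  proof (rule mult_nonneg_nonneg)
    show "0 \<le> real (card A) - 2" using card by linarith
    have "y \<in> A" using y(1) by blast
    then show "0 \<le> F y - F x" using x(2)[of y] by linarith
  qed
  then have "(F x + F y) * card A \<le> (F x + F y) * card A + (real (card A) - 2) * (F y - F x)"
    by (rule add_increasing2) (rule order_refl)
  also have "\<dots> = 2 * (F x + (real (card A) - 1) * F y)"
    by algebra
  also have "\<dots> \<le> 2 * (c * card A)"
    by (rule mult_left_mono[OF avg']) (rule zero_le_numeral)
  also have "\<dots> = (2 * c) * card A"
    by (rule mult.assoc[symmetric])
  finally have "(F x + F y) * card A \<le> (2 * c) * card A" .
  then have "F x + F y \<le> 2 * c"
    by (rule mult_right_le_imp_le) (use card in linarith)
  moreover have "y \<in> A" "x \<noteq> y" using y(1) by auto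
  ultimately show ?thesis using x(1) by (intro bexI[of _ x] bexI[of _ y] conjI)
qed

text \<open>
  If all cuts of all coordinates were inefficient, then \<open>weight\<close> of the distance to the medians
  would average to at most \<open>2.85\<close> over \<open>A\<close> and the coordinates. Take two points \<open>x, y\<close> whose
  averages over the coordinates sum to at most \<open>2 \<cdot> 2.85\<close>. Then \<open>|x i - y i|\<close> is at most twice
  the larger of the distances to the \<open>i\<close>-th median, so that its contribution after rescaling is at most the larger of the two weights; the smaller
  one is at least \<open>e > 2.7\<close>, and \<open>2 \<cdot> 2.85 - 2.7 = 3\<close>. The dilation by \<open>400\<close> matches the \<open>200\<close>
  in \<open>weight\<close>.
\<close>

lemma separated_set_splits:
  assumes fin: "finite A" and card: "card A \<ge> 2" and n: "n \<ge> 1"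
    and space: "A \<subseteq> topspace (Euclidean_space n)"
    and sep: "separated n (dilate (1/400) A)"
  shows "\<exists>i<n. \<exists>a::int. {x \<in> A. x i \<le> of_int a} \<noteq> {} \<and> {x \<in> A. x i \<ge> of_int a + 1} \<noteq> {} \<and>
     root 4 (card A) \<le> root 4 (card {x \<in> A. x i \<le> of_int a}) + root 4 (card {x \<in> A. x i \<ge> of_int a + 1})"
proof (rule ccontr)
  assume contr: "\<not> ?thesis"
  have cut: "no_efficient_cut A (\<lambda>x. x i)" if "i < n" for i
    unfolding no_efficient_cut_def
  proof (intro allI impI, rule ccontr)
    fix a :: int
    assume "{x \<in> A. x i \<le> of_int a} \<noteq> {}" "{x \<in> A. of_int a + 1 \<le> x i} \<noteq> {}"
      "\<not> root 4 (card {x \<in> A. x i \<le> of_int a}) + root 4 (card {x \<in> A. of_int a + 1 \<le> x i})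
          < root 4 (card A)"
    with that show False using contr unfolding not_less by blast
  qed
  have ne: "A \<noteq> {}" using card by auto
  define m where
    "m i = (SOME m::int. (\<Sum>x\<in>A. weight \<bar>x i - of_int m\<bar>) \<le> 2.85 * card A)" for i
  have m: "(\<Sum>x\<in>A. weight \<bar>x i - of_int (m i)\<bar>) \<le> 2.85 * card A" if "i < n" for i
    unfolding m_def by (rule someI_ex[OF concentration[OF fin ne cut[OF that]]])
  define F where "F x = (\<Sum>i<n. weight \<bar>x i - of_int (m i)\<bar>)" for x
  have "(\<Sum>x\<in>A. F x) = (\<Sum>i<n. \<Sum>x\<in>A. weight \<bar>x i - of_int (m i)\<bar>)"
    unfolding F_def by (rule sum.swap)
  also have "\<dots> \<le> (\<Sum>i<n. 2.85 * card A)"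
    by (intro sum_mono m) auto
  finally have "(\<Sum>x\<in>A. F x) \<le> (2.85 * n) * card A" by (simp add: algebra_simps)
  from two_small_values[OF fin card this] obtain x y
    where xy: "x \<in> A" "y \<in> A" "x \<noteq> y" and Fxy: "F x + F y \<le> 2 * (2.85 * n)"
    by blast
  define d where "d = (\<lambda>i. 1/400 * x i - 1/400 * y i)"
  have pt: "exp (exp \<bar>d i\<bar>) \<le> weight \<bar>x i - of_int (m i)\<bar> + weight \<bar>y i - of_int (m i)\<bar> - 2.7" for i
  proof -
    define r where "r = \<bar>x i - of_int (m i)\<bar>"
    define s where "s = \<bar>y i - of_int (m i)\<bar>"
    have e: "exp 1 \<ge> (2.7 :: real)"
      using e_approx_32 unfolding abs_le_iff by simp
    have w: "weight t \<ge> 2.7" if "t \<ge> 0" for t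
    proof -
      have "exp 1 \<le> weight t" unfolding weight_def using that by simp
      then show ?thesis using e by linarith
    qed
    have "d i = (x i - y i) / 400" by (simp add: d_def diff_divide_distrib)
    then have "\<bar>d i\<bar> = \<bar>x i - y i\<bar> / 400" by simp
    also have "\<bar>x i - y i\<bar> \<le> r + s"
      unfolding r_def s_def by linarith
    also have "(r + s) / 400 \<le> max r s / 200" by simp
    finally have "exp (exp \<bar>d i\<bar>) \<le> weight (max r s)" unfolding weight_def by simp
    also have "\<dots> \<le> weight r + weight s - 2.7"
      using w[of r] w[of s] by (auto simp: max_def r_def s_def)
    finally show ?thesis unfolding r_def s_def .
  qed
  have "(\<Sum>i<n. exp (exp \<bar>d i\<bar>)) \<le>
        (\<Sum>i<n. weight \<bar>x i - of_int (m i)\<bar> + weight \<bar>y i - of_int (m i)\<bar> - 2.7)"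
    by (intro sum_mono pt)
  also have "\<dots> = F x + F y - 2.7 * n"
    unfolding F_def by (simp add: sum.distrib sum_subtractf)
  also have "\<dots> \<le> 3 * n" using Fxy by simp
  finally have "(\<Sum>i<n. exp (exp \<bar>d i\<bar>)) \<le> 3 * n" .
  moreover have "d i = 0" if "i \<ge> n" for i
    using subsetD[OF space xy(1)] subsetD[OF space xy(2)] that
    by (simp add: d_def topspace_Euclidean_space)
  ultimately have "d \<in> exp_exp_body n"
    using n by (simp add: exp_exp_body_def topspace_Euclidean_space field_simps)
  moreover have "d \<notin> exp_exp_body n"
  proof -
    have "(\<lambda>i. 1/400 * x i) \<noteq> (\<lambda>i. 1/400 * y i)"
      using xy(3) by (auto simp: fun_eq_iff)
    moreover have "(\<lambda>i. 1/400 * x i) \<in> dilate (1/400) A" "(\<lambda>i. 1/400 * y i) \<in> dilate (1/400) A"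
      using xy by (auto simp: dilate_def)
    ultimately show ?thesis
      using sep unfolding separated_def d_def by blast
  qed
  ultimately show False by blast
qed

lemma dilate_dilate: "dilate c (dilate d K) = dilate (c * d) K"
  by (simp add: dilate_def image_image mult.assoc)

lemma dilate_1 [simp]: "dilate 1 K = K"
  by (simp add: dilate_def)

lemma coord_bounded_dilate:
  assumes "coord_bounded n K"
  shows "coord_bounded n (dilate c K)"
proof -
  obtain B :: int where B: "\<And>x i. x \<in> K \<Longrightarrow> i < n \<Longrightarrow> \<bar>x i\<bar> \<le> of_int B"
    using assms unfolding coord_bounded_def by blast
  have "\<bar>c * x i\<bar> \<le> of_int \<lceil>\<bar>c\<bar> * of_int B\<rceil>" if "x \<in> K" "i < n" for x i
    using mult_left_mono[OF B[OF that], of "\<bar>c\<bar>"] by (simp add: abs_mult) linarith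
  then show ?thesis unfolding coord_bounded_def dilate_def by blast
qed

lemma coord_convex_dilate:
  assumes "coord_convex K"
  shows "coord_convex (dilate c K)"
  unfolding coord_convex_def
proof (intro ballI allI impI)
  fix x y and u v :: real assume "x \<in> dilate c K" "y \<in> dilate c K" and uv: "0 \<le> u" "0 \<le> v" "u + v = 1"
  then obtain x' y' where xy: "x' \<in> K" "y' \<in> K" "x = (\<lambda>i. c * x' i)" "y = (\<lambda>i. c * y' i)"
    unfolding dilate_def by blast
  then have "(\<lambda>i. u * x' i + v * y' i) \<in> K"
    using assms uv unfolding coord_convex_def by blast
  then show "(\<lambda>i. u * x i + v * y i) \<in> dilate c K"
    unfolding dilate_def xy(3,4) by (rule rev_image_eqI) (simp add: algebra_simps)
qed

lemma card_separated_le: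
  assumes n: "n \<ge> 1" and conv: "coord_convex K" and bd: "coord_bounded n K"
    and space: "K \<subseteq> topspace (Euclidean_space n)"
    and A: "finite A" "A \<subseteq> K" "A \<noteq> {}" "separated n A"
  shows "card A \<le> cell_content n (dilate 400 K) ^ 4"
proof -
  define A' where "A' = dilate 400 A"
  have inj: "inj_on (\<lambda>x i. 400 * x i :: real) A"
    by (rule inj_onI) (simp add: fun_eq_iff)
  have c: "card A' = card A" unfolding A'_def dilate_def by (rule card_image[OF inj])
  have inv: "dilate (1/400) A' = A"
    by (simp add: A'_def dilate_dilate)
  have "root 4 (card A') \<le> card (cell_indices n (dilate 400 K))"
  proof (rule root_card_le_cell_indices)
    fix B assume B: "B \<subseteq> A'" "2 \<le> card B"
    have "dilate (1/400) B \<subseteq> A"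
      unfolding inv[symmetric] dilate_def by (rule image_mono[OF B(1)])
    then have sep: "separated n (dilate (1/400) B)"
      using A(4) unfolding separated_def by blast
    have "B \<subseteq> topspace (Euclidean_space n)"
      using B(1) A(2) space unfolding A'_def dilate_def topspace_Euclidean_space by fastforce
    moreover have "finite B" using B(2) card.infinite by fastforce
    ultimately show "\<exists>i<n. \<exists>a::int. {x \<in> B. x i \<le> of_int a} \<noteq> {} \<and> {x \<in> B. x i \<ge> of_int a + 1} \<noteq> {} \<and>
       root 4 (card B) \<le> root 4 (card {x \<in> B. x i \<le> of_int a}) + root 4 (card {x \<in> B. x i \<ge> of_int a + 1})"
      using separated_set_splits[OF _ B(2) n _ sep] by blast
  next
    show "coord_convex (dilate 400 K)" by (rule coord_convex_dilate[OF conv])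
    show "coord_bounded n (dilate 400 K)" by (rule coord_bounded_dilate[OF bd])
    show "finite A'" "A' \<subseteq> dilate 400 K" "A' \<noteq> {}"
      using A(1-3) unfolding A'_def dilate_def by auto
  qed
  then have "root 4 (card A) \<le> cell_content n (dilate 400 K)"
    by (simp add: c cell_content_eq_card coord_bounded_dilate bd)
  then have "root 4 (card A) ^ 4 \<le> real (cell_content n (dilate 400 K)) ^ 4"
    by (intro power_mono) auto
  then have "real (card A) \<le> real (cell_content n (dilate 400 K) ^ 4)" by simp
  then show ?thesis by linarith
qed

section \<open>Covering by a maximal separated set\<close>

lemma exp_exp_body_uminus: "x \<in> exp_exp_body n \<Longrightarrow> (\<lambda>i. - x i) \<in> exp_exp_body n"
  by (simp add: exp_exp_body_def topspace_Euclidean_space)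

lemma zero_in_exp_exp_body: "n \<ge> 1 \<Longrightarrow> (\<lambda>_. 0) \<in> exp_exp_body n"
  using exp_le by (simp add: exp_exp_body_def topspace_Euclidean_space)

lemma covering_number_le_card:
  assumes fin: "finite A" and space: "A \<subseteq> topspace (Euclidean_space n)"
    and cover: "K \<subseteq> (\<Union>x\<in>A. translate x D)"
  shows "covering_number n K D \<le> enat (card A)"
proof -
  obtain h where h: "bij_betw h {1..card A} A"
    using ex_bij_betw_nat_finite_1[OF fin] by blast
  then have im: "h ` {1..card A} = A" by (simp add: bij_betw_def)
  have "\<exists>x :: nat \<Rightarrow> nat \<Rightarrow> real. (\<forall>j\<in>{1..card A}. x j \<in> topspace (Euclidean_space n)) \<and>
            K \<subseteq> (\<Union>j\<in>{1..card A}. translate (x j) D)"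
  proof (intro exI[of _ h] conjI)
    show "\<forall>j\<in>{1..card A}. h j \<in> topspace (Euclidean_space n)"
      using space im by blast
    have "(\<Union>j\<in>{1..card A}. translate (h j) D) = (\<Union>x\<in>h ` {1..card A}. translate x D)"
      by simp
    then show "K \<subseteq> (\<Union>j\<in>{1..card A}. translate (h j) D)"
      using cover im by (simp only:)
  qed
  then show ?thesis
    unfolding covering_number_def by (intro Inf_lower) blast
qed

lemma maximal_separated_covers:
  assumes n: "n \<ge> 1" and space: "K \<subseteq> topspace (Euclidean_space n)"
    and A: "separated n A" "A \<subseteq> K"
    and max: "\<And>y. y \<in> K \<Longrightarrow> separated n (insert y A) \<Longrightarrow> y \<in> A"
  shows "K \<subseteq> (\<Union>x\<in>A. translate x (exp_exp_body n))"
proof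
  fix y assume y: "y \<in> K"
  have "\<exists>x\<in>A. (\<lambda>i. y i - x i) \<in> exp_exp_body n"
  proof (cases "y \<in> A")
    case True
    then show ?thesis using zero_in_exp_exp_body[OF n] by (intro bexI[of _ y]) auto
  next
    case False
    then have "\<not> separated n (insert y A)" using max y by blast
    then obtain x where "x \<in> A" "(\<lambda>i. y i - x i) \<in> exp_exp_body n \<or> (\<lambda>i. x i - y i) \<in> exp_exp_body n"
      using A(1) unfolding separated_def by blast
    then show ?thesis using exp_exp_body_uminus[of "\<lambda>i. x i - y i" n] by auto
  qed
  then obtain x where x: "x \<in> A" "(\<lambda>i. y i - x i) \<in> exp_exp_body n" by blast
  have "y \<in> translate x (exp_exp_body n)"
    unfolding translate_def using x(2) by (rule rev_image_eqI) simp
  then show "y \<in> (\<Union>x\<in>A. translate x (exp_exp_body n))" using x(1) by blast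
qed

lemma coord_bounded_compactin:
  assumes "compactin (Euclidean_space n) K"
  shows "coord_bounded n K"
proof -
  have "\<exists>b. \<forall>x\<in>K. \<bar>x i\<bar> \<le> b" for i
  proof -
    have "continuous_map (Euclidean_space n) euclideanreal (\<lambda>x. x i)"
      unfolding Euclidean_space_def
      by (intro continuous_map_from_subtopology continuous_map_product_projection) auto
    then have "compact ((\<lambda>x. x i) ` K)"
      using image_compactin[OF assms] compactin_euclidean_iff by blast
    then show ?thesis
      using compact_imp_bounded by (fastforce simp: bounded_iff)
  qed
  then obtain b where b: "\<And>i x. x \<in> K \<Longrightarrow> \<bar>x i\<bar> \<le> b i" by metis
  have "\<bar>x i\<bar> \<le> of_int \<lceil>\<Sum>j<n. \<bar>b j\<bar>\<rceil>" if "x \<in> K" "i < n" for x i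
  proof -
    have "\<bar>b i\<bar> \<le> (\<Sum>j<n. \<bar>b j\<bar>)" using that by (intro member_le_sum) auto
    then show ?thesis using b[OF that(1), of i] by linarith
  qed
  then show ?thesis unfolding coord_bounded_def by blast
qed

text \<open>
  Finite separated subsets of \<open>K\<close> have bounded size, so one of greatest size exists; it is
  maximal and hence gives a cover.
\<close>

lemma covering_number_le_power_cell_content:
  assumes n: "n \<ge> 1" and K: "convex_body n K"
  shows "covering_number n K (exp_exp_body n) \<le> enat (cell_content n (dilate 400 K) ^ 4)"
proof -
  have cpt: "compactin (Euclidean_space n) K" and conv: "coord_convex K"
    and "Euclidean_space n interior_of K \<noteq> {}"
    using K unfolding convex_body_def coord_convex_def by blast+
  then obtain p where p: "p \<in> K"
    using interior_of_subset[of "Euclidean_space n" K] by blast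
  have space: "K \<subseteq> topspace (Euclidean_space n)" by (rule compactin_subset_topspace[OF cpt])
  have bd: "coord_bounded n K" by (rule coord_bounded_compactin[OF cpt])
  define P where "P A \<longleftrightarrow> finite A \<and> A \<subseteq> K \<and> A \<noteq> {} \<and> separated n A" for A
  have bound: "card A \<le> cell_content n (dilate 400 K) ^ 4" if "P A" for A
    using card_separated_le[OF n conv bd space] that unfolding P_def by blast
  have "P {p}" using p unfolding P_def separated_def by auto
  then obtain A where A: "P A" "\<And>B. P B \<Longrightarrow> card B \<le> card A"
    using ex_has_greatest_nat[of P "{p}" card "Suc (cell_content n (dilate 400 K) ^ 4)"] bound
    by (meson le_imp_less_Suc)
  have "K \<subseteq> (\<Union>x\<in>A. translate x (exp_exp_body n))"
  proof (rule maximal_separated_covers[OF n space])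
    fix y assume "y \<in> K" "separated n (insert y A)"
    then have "P (insert y A)" using A(1) unfolding P_def by blast
    then have "card (insert y A) \<le> card A" by (rule A(2))
    then show "y \<in> A"
      using A(1) unfolding P_def by (cases "y \<in> A") auto
  qed (use A(1) in \<open>auto simp: P_def\<close>)
  then have "covering_number n K (exp_exp_body n) \<le> enat (card A)"
    using A(1) space by (intro covering_number_le_card) (auto simp: P_def)
  also have "\<dots> \<le> enat (cell_content n (dilate 400 K) ^ 4)" using bound[OF A(1)] by simp
  finally show ?thesis .
qed

theorem theorem2p2:
  "\<exists>C::real. C > 0 \<and>
     (\<forall>n\<ge>1. \<forall>K. convex_body n K \<longrightarrow>
        ereal_of_enat (covering_number n K (exp_exp_body n))
          \<le> ereal (real (cell_content n (dilate C K)) powr C))"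
proof (intro exI[of _ 400] conjI allI impI)
  \<comment> \<open>\<open>C = 400\<close> is dictated by the dilation; as an exponent it is weaker than \<open>4\<close>.\<close>
  fix n :: nat and K assume n: "n \<ge> 1" and K: "convex_body n K"
  let ?S = "cell_content n (dilate 400 K)"
  have "ereal_of_enat (covering_number n K (exp_exp_body n)) \<le> ereal (real (?S ^ 4))"
    using covering_number_le_power_cell_content[OF n K]
    by (simp flip: ereal_of_enat_le_iff)
  \<comment> \<open>The base is a natural number, so the power grows with the exponent.\<close>
  also have "real (?S ^ 4) \<le> real ?S powr 400"
  proof (cases "?S = 0")
    case False
    then have "real ?S powr 4 \<le> real ?S powr 400"
      by (intro powr_mono) auto
    with False show ?thesis by (simp add: powr_numeral)
  qed simp
  finally show "ereal_of_enat (covering_number n K (exp_exp_body n)) \<le> ereal (real ?S powr 400)"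
    by simp
qed simp

end
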